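(* For every positive integer $n$, $$\sum_{a\in\mathbb{Z}_n^*}\psi\bigl(\mathbb{Z}_{\gcd(a-1,n)}\bigr)=\varphi(n)\,\sigma(n),$$ where $\sigma(n)$ is the sum of the (positive) divisors of $n$.
   Context: For a positive integer $m$, $\mathbb{Z}_m=\mathbb{Z}/m\mathbb{Z}$ is the (additive) cyclic group of order $m$. For a finite group $H$, $\psi(H)=\sum_{h\in H}o(h)$, where $o(h)$ is the order of $h$ in $H$. $\mathbb{Z}_n^*=\{a\in\mathbb{N} : 1\le a\le n,\ \gcd(a,n)=1\}$ is the group of units modulo $n$, with the convention $\gcd(0,n)=n$, and $\varphi$ is Euler's totient function. *)

theory Defs
  imports "HOL-Algebra.Multiplicative_Group" "HOL-Algebra.Elementary_Groups" "HOL-Number_Theory.Totient"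
begin

text \<open>
  Intended for finite groups: an element of infinite order has order 0 in
  \<^const>\<open>group.ord\<close>, and the sum over an infinite carrier is 0.
\<close>
definition psi :: "('a, 'b) monoid_scheme \<Rightarrow> nat" where
  "psi H = (\<Sum>h\<in>carrier H. group.ord H h)"

definition sigma :: "nat \<Rightarrow> nat" where
  "sigma n = (\<Sum>d | d dvd n. d)"

end

theory Submission
  imports Defs
begin

text \<open>
  The identity is a double count. In the cyclic group of order \<open>m\<close> there are \<open>\<phi>(d)\<close> elements of
  each order \<open>d\<close> dividing \<open>m\<close>, so \<open>\<psi>(\<int>\<^sub>m)\<close> is the sum of \<open>d \<phi>(d)\<close> over the divisors \<open>d\<close> of \<open>m\<close>
  (lemma \<open>psi_integer_mod_group\<close>). With \<open>m = gcd (a - 1) n\<close> these are the divisors \<open>d\<close> of \<open>n\<close> with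
  \<open>a \<equiv> 1\<close> modulo \<open>d\<close>. Exchanging the two summations, a divisor \<open>d\<close> of \<open>n\<close> contributes
  \<open>d \<phi>(d)\<close> once for every unit modulo \<open>n\<close> in the kernel of the reduction map from the units modulo
  \<open>n\<close> to the units modulo \<open>d\<close>. This map is surjective, because every residue class coprime to \<open>d\<close>
  contains a number coprime to \<open>n\<close> (lemma \<open>ex_coprime_lift\<close>), and all its fibres have the same size
  (lemma \<open>card_fibre_eq\<close>). So the kernel has \<open>\<phi>(n) / \<phi>(d)\<close> elements (lemma
  \<open>totient_mult_card_kernel\<close>), the contribution of \<open>d\<close> is \<open>d \<phi>(n)\<close>, and summing over \<open>d\<close> gives
  \<open>\<phi>(n) \<sigma>(n)\<close>.
\<close>

lemma ord_integer_mod_group: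
  fixes k m :: nat
  assumes "k < m"
  shows "group.ord (integer_mod_group m) (int k) = m div gcd k m"
proof -
  have m: "m > 0" using assms by simp
  have mem: "int k \<in> carrier (integer_mod_group m)"
    using assms by (simp add: carrier_integer_mod_group)
  have dvd: "m dvd i * k \<longleftrightarrow> m div gcd k m dvd i" for i :: nat
  proof -
    define g where "g = gcd k m"
    have g: "g > 0" using m by (simp add: g_def)
    obtain k' m' where k': "k = k' * g" and m': "m = m' * g" and cop: "coprime k' m'"
      using gcd_coprime_exists[of k m] m unfolding g_def by auto
    have "m dvd i * k \<longleftrightarrow> m' * g dvd (i * k') * g"
      by (simp only: k' m' mult.assoc)
    also have "\<dots> \<longleftrightarrow> m' dvd i"
      using g cop by (simp add: coprime_dvd_mult_left_iff coprime_commute)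
    also have "m' = m div gcd k m"
      using g m' by (metis g_def nonzero_mult_div_cancel_right not_gr_zero)
    finally show ?thesis .
  qed
  have "(int i * int k) mod int m = 0 \<longleftrightarrow> m div gcd k m dvd i" for i :: nat
    by (metis dvd dvd_eq_mod_eq_0 int_dvd_int_iff of_nat_mult)
  then show ?thesis
    by (simp add: group.ord_unique[OF group_integer_mod_group mem])
qed

text \<open>
  Elements are grouped by their gcd with \<open>m\<close>: gcd \<open>d\<close> means order \<open>m / d\<close>, and it occurs
  \<open>\<phi>(m / d)\<close> times.
\<close>
lemma psi_integer_mod_group:
  assumes "m > 0"
  shows "psi (integer_mod_group m) = (\<Sum>d | d dvd m. d * totient d)"
proof -
  let ?ord = "group.ord (integer_mod_group m)"
  have fin: "finite {d. d dvd m}" using assms by simp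
  \<comment> \<open>Passing to inverses turns the representatives \<open>0, ..., m - 1\<close> into \<open>1, ..., m\<close>, over which
    the count of a given gcd by the totient function runs.\<close>
  have "psi (integer_mod_group m) = (\<Sum>k\<in>{0<..m}. ?ord (int (m - k)))"
    unfolding psi_def
    by (rule sum.reindex_bij_witness[where i = "\<lambda>k. int (m - k)" and j = "\<lambda>h. nat (int m - h)"])
       (use assms in \<open>auto simp: carrier_integer_mod_group of_nat_diff nat_le_iff\<close>)
  also have "\<dots> = (\<Sum>k\<in>{0<..m}. m div gcd k m)"
  proof (intro sum.cong refl)
    fix k assume "k \<in> {0<..m}"
    then have "m - k < m" "gcd (m - k) m = gcd k m"
      using gcd_diff2_nat[of k m] by auto
    then show "?ord (int (m - k)) = m div gcd k m"
      by (simp only: ord_integer_mod_group)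
  qed
  also have "\<dots> = (\<Sum>d | d dvd m. \<Sum>k | k \<in> {0<..m} \<and> gcd k m = d. m div gcd k m)"
    by (rule sum.group[symmetric]) (use fin in auto)
  also have "\<dots> = (\<Sum>d | d dvd m. (m div d) * totient (m div d))"
  proof (intro sum.cong refl)
    fix d assume d: "d \<in> {d. d dvd m}"
    have "(\<Sum>k | k \<in> {0<..m} \<and> gcd k m = d. m div gcd k m)
        = (\<Sum>k | k \<in> {0<..m} \<and> gcd k m = d. m div d)"
      by (intro sum.cong refl) auto
    then show "(\<Sum>k | k \<in> {0<..m} \<and> gcd k m = d. m div gcd k m) = (m div d) * totient (m div d)"
      using card_gcd_eq_totient[OF assms, of d] d by simp
  qed
  also have "\<dots> = (\<Sum>d | d dvd m. d * totient d)"
    by (rule sum.reindex_bij_witness[where i = "\<lambda>d. m div d" and j = "\<lambda>d. m div d"])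
       (use assms in \<open>auto elim!: dvdE\<close>)
  finally show ?thesis .
qed

text \<open>
  The lift is \<open>b + d t\<close>, where \<open>t\<close> is the product of the primes that divide \<open>n\<close> but not \<open>b\<close>: then
  every prime factor of \<open>n\<close> divides exactly one of the two summands.
\<close>
lemma ex_coprime_lift:
  fixes b d n :: nat
  assumes "n > 0" "coprime b d"
  shows "\<exists>x. coprime x n \<and> [x = b] (mod d)"
proof -
  define P where "P = {p. prime p \<and> p dvd n \<and> \<not> p dvd b}"
  define t where "t = \<Prod>P"
  have finP: "finite P"
    by (rule finite_subset[of _ "{p. p dvd n}"]) (use assms in \<open>auto simp: P_def\<close>)
  have "\<not> p dvd b + d * t" if p: "prime p" "p dvd n" for p
  proof (cases "p dvd b")
    case True
    have "\<not> p dvd d"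
      using assms(2) True p(1) by (meson coprime_common_divisor not_prime_unit)
    moreover have "\<not> p dvd t"
    proof
      assume "p dvd t"
      then obtain q where q: "q \<in> P" "p dvd q"
        using p finP by (auto simp: t_def prime_dvd_prod_iff)
      then have "p = q" using p by (auto simp: P_def primes_dvd_imp_eq)
      then show False using q True by (auto simp: P_def)
    qed
    ultimately have "\<not> p dvd d * t" using p by (simp add: prime_dvd_mult_iff)
    then show ?thesis using True by (simp add: dvd_add_right_iff)
  next
    case False
    then have "p dvd t" unfolding t_def using p finP by (intro dvd_prodI) (auto simp: P_def)
    then show ?thesis using False by (simp add: dvd_add_left_iff)
  qed
  then have "coprime (b + d * t) n"
    using prime_factor_nat[of "gcd (b + d * t) n"] by (auto simp: coprime_iff_gcd_eq_1)
  moreover have "[b + d * t = b] (mod d)" by (simp add: cong_def)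
  ultimately show ?thesis by blast
qed

text \<open>Multiplication by a unit \<open>x\<close> modulo \<open>n\<close> embeds the fibre over \<open>b\<close> into the one over \<open>x b\<close>.\<close>
lemma card_fibre_le:
  fixes b c d n x :: nat
  assumes n: "n > 1" and d: "d dvd n" and x: "coprime x n" and xb: "[x * b = c] (mod d)"
  shows "card {a \<in> totatives n. [a = b] (mod d)} \<le> card {a \<in> totatives n. [a = c] (mod d)}"
proof (rule card_inj_on_le[where f = "\<lambda>a. x * a mod n"])
  show "inj_on (\<lambda>a. x * a mod n) {a \<in> totatives n. [a = b] (mod d)}"
  proof (rule inj_onI)
    fix a a' assume a: "a \<in> {a \<in> totatives n. [a = b] (mod d)}" "a' \<in> {a \<in> totatives n. [a = b] (mod d)}"
      and eq: "x * a mod n = x * a' mod n"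
    then have "[a = a'] (mod n)"
      using cong_mult_lcancel_nat[OF x] by (simp add: cong_def)
    moreover have "a < n" "a' < n" using a n totatives_less by auto
    ultimately show "a = a'" by (rule cong_less_modulus_unique_nat)
  qed
  show "(\<lambda>a. x * a mod n) ` {a \<in> totatives n. [a = b] (mod d)} \<subseteq> {a \<in> totatives n. [a = c] (mod d)}"
  proof (intro image_subsetI CollectI conjI)
    fix a assume a: "a \<in> {a \<in> totatives n. [a = b] (mod d)}"
    have cop: "coprime (x * a mod n) n" using a x n by (simp add: in_totatives_iff)
    then have "x * a mod n \<noteq> 0" using n by (metis coprime_0_left_iff nat_dvd_1_iff_1 less_irrefl)
    then show "x * a mod n \<in> totatives n"
      using cop n by (simp add: in_totatives_iff less_imp_le)
    have "[x * a mod n = x * a] (mod d)"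
      using d by (simp add: cong_def mod_mod_cancel)
    also have "[x * a = x * b] (mod d)" using a by (simp add: cong_scalar_left)
    also note xb
    finally show "[x * a mod n = c] (mod d)" .
  qed
qed simp

text \<open>A unit \<open>x\<close> lifting \<open>b\<close> and an inverse \<open>y\<close> of \<open>x\<close> modulo \<open>n\<close> give embeddings in both directions.\<close>
lemma card_fibre_eq:
  fixes b d n :: nat
  assumes n: "n > 1" and d: "d dvd n" and b: "coprime b d"
  shows "card {a \<in> totatives n. [a = b] (mod d)} = card {a \<in> totatives n. [a = 1] (mod d)}"
proof (rule antisym)
  obtain x where x: "coprime x n" "[x = b] (mod d)"
    using ex_coprime_lift[OF _ b] n by (metis gr_implies_not0 neq0_conv)
  obtain y where y: "[x * y = 1] (mod n)"
    using cong_solve_coprime_nat[OF x(1)] by auto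
  have "coprime y n"
    using y by (metis One_nat_def coprime_iff_invertible_nat mult.commute)
  moreover have "[y * b = 1] (mod d)"
  proof -
    have "[y * b = y * x] (mod d)" using x(2) by (simp add: cong_scalar_left cong_sym)
    also have "[y * x = 1] (mod d)"
      using cong_dvd_modulus_nat[OF y d] by (simp add: mult.commute)
    finally show ?thesis .
  qed
  ultimately show "card {a \<in> totatives n. [a = b] (mod d)} \<le> card {a \<in> totatives n. [a = 1] (mod d)}"
    by (rule card_fibre_le[OF n d])
  show "card {a \<in> totatives n. [a = 1] (mod d)} \<le> card {a \<in> totatives n. [a = b] (mod d)}"
    by (rule card_fibre_le[OF n d x(1)]) (use x(2) in simp)
qed

lemma totient_mult_card_kernel:
  fixes d n :: nat
  assumes n: "n > 0" and d: "d dvd n"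
  shows "totient d * card {a \<in> totatives n. [a = 1] (mod d)} = totient n"
proof (cases "d = 1")
  case True
  then show ?thesis by (simp add: totient_def)
next
  case False
  \<comment> \<open>For \<open>d > 1\<close> the set \<open>totatives d\<close> consists of reduced residues, so it contains \<open>a mod d\<close> for
    every unit \<open>a\<close>; for \<open>d = 1\<close> it would be \<open>{1}\<close> instead of \<open>{0}\<close>.\<close>
  have d0: "d > 0" using n d by (simp add: dvd_pos_nat)
  then have d1: "d > 1" using False by simp
  then have n1: "n > 1" using dvd_imp_le[OF d n] by simp
  have red: "a mod d \<in> totatives d" if "a \<in> totatives n" for a
  proof -
    have cop: "coprime (a mod d) d"
      using that d d0 coprime_divisors[OF dvd_refl d, of a] by (simp add: in_totatives_iff)
    then have "a mod d \<noteq> 0" using d1 by (metis coprime_0_left_iff nat_dvd_1_iff_1 less_irrefl)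
    then show ?thesis using cop d0 by (simp add: in_totatives_iff less_imp_le)
  qed
  have "totient n = (\<Sum>a\<in>totatives n. 1)" by (simp add: totient_def)
  also have "\<dots> = (\<Sum>b\<in>totatives d. \<Sum>a | a \<in> totatives n \<and> a mod d = b. 1)"
    by (rule sum.group[symmetric]) (use red in auto)
  also have "\<dots> = (\<Sum>b\<in>totatives d. card {a \<in> totatives n. [a = 1] (mod d)})"
  proof (intro sum.cong refl)
    fix b assume b: "b \<in> totatives d"
    have "{a \<in> totatives n. a mod d = b} = {a \<in> totatives n. [a = b] (mod d)}"
      using totatives_less[OF b d1] by (simp add: cong_def)
    then show "(\<Sum>a | a \<in> totatives n \<and> a mod d = b. 1) = card {a \<in> totatives n. [a = 1] (mod d)}"
      using card_fibre_eq[OF n1 d, of b] b by (simp add: in_totatives_iff)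
  qed
  finally show ?thesis by (simp add: totient_def)
qed

theorem corollary2:
  fixes n :: nat
  assumes "n > 0"
  shows "(\<Sum>a\<in>totatives n. psi (integer_mod_group (gcd (a - 1) n))) = totient n * sigma n"
proof -
  have "(\<Sum>a\<in>totatives n. psi (integer_mod_group (gcd (a - 1) n)))
      = (\<Sum>a\<in>totatives n. \<Sum>d | d \<in> {d. d dvd n} \<and> [a = 1] (mod d). d * totient d)"
  proof (intro sum.cong refl)
    fix a assume "a \<in> totatives n"
    then have "a \<ge> 1" by (simp add: in_totatives_iff)
    then have "{d. d dvd gcd (a - 1) n} = {d. d \<in> {d. d dvd n} \<and> [a = 1] (mod d)}"
      by (auto simp: cong_altdef_nat)
    then show "psi (integer_mod_group (gcd (a - 1) n))
        = (\<Sum>d | d \<in> {d. d dvd n} \<and> [a = 1] (mod d). d * totient d)"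
      using assms by (simp add: psi_integer_mod_group)
  qed
  also have "\<dots> = (\<Sum>d | d dvd n. \<Sum>a | a \<in> totatives n \<and> [a = 1] (mod d). d * totient d)"
    by (rule sum.swap_restrict) (use assms in auto)
  also have "\<dots> = (\<Sum>d | d dvd n. d * totient n)"
    by (intro sum.cong refl)
       (use totient_mult_card_kernel[OF assms] in \<open>simp add: mult_ac\<close>)
  also have "\<dots> = totient n * sigma n"
    by (simp add: sigma_def sum_distrib_left mult.commute)
  finally show ?thesis .
qed

end
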